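(* Let $A$ be a Banach algebra with a right unit, and suppose $A = B\oplus I$, where $B$ is a closed unital subalgebra of $A$ and $I$ is a closed two-sided ideal of $A$ contained in the set of right annihilators of $A$ (i.e. $ax=0$ for all $a\in A$, $x\in I$). Then: (i) for every closed two-sided ideal $J$ in $B$, $J\oplus I$ is a closed two-sided ideal in $A$; (ii) if $A$ is ideally amenable, then $B$ is ideally amenable.
   Context: A right unit of $A$ is an element $e\in A$ with $ae=a$ for all $a\in A$. "Unital subalgebra" means that $B$ has its own identity element $1_B$. For a Banach algebra $A$ and a Banach $A$-bimodule $X$, the dual $X^*$ is a Banach $A$-bimodule via $\langle a\cdot\xi,x\rangle=\langle \xi,x\cdot a\rangle$, $\langle \xi\cdot a,x\rangle=\langle\xi,a\cdot x\rangle$; $H^1(A,X^* )$ is the space of continuous derivations $D:A\to X^*$ ($D(ab)=a\cdot D(b)+D(a)\cdot b$) modulo inner derivations $a\mapsto a\cdot\xi-\xi\cdot a$. $A$ is ideally amenable if $H^1(A,J^* )=\{0\}$ for every closed two-sided ideal $J$ of $A$. *)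

theory Defs
  imports Complex_Main "HOL-Library.Set_Algebras"
begin

text \<open>
  Every real normed field is isometrically isomorphic to the reals or to the complex numbers
  (Gelfand--Mazur), so the type variable \<open>'k\<close> covers exactly real and complex Banach algebras.
  The type classes on \<open>'a\<close> provide completeness, the submultiplicative norm and the underlying
  real scalar multiplication, with which \<open>scale\<close> has to agree. No identity element is assumed.
\<close>

locale banach_algebra = vector_space scale
  for scale :: "'k::real_normed_field \<Rightarrow> 'a::{real_normed_algebra, banach} \<Rightarrow> 'a" +
  assumes scale_of_real: "scale (of_real r) x = r *\<^sub>R x"
    and norm_scale: "norm (scale c x) = norm c * norm x"
    and scale_mult_left: "scale c x * y = scale c (x * y)"
    and scale_mult_right: "x * scale c y = scale c (x * y)"

definition direct_sum :: "'a::ab_group_add set \<Rightarrow> 'a set \<Rightarrow> 'a set \<Rightarrow> bool" where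
  "direct_sum W U V \<longleftrightarrow> W = U + V \<and> U \<inter> V = {0}"

definition closed_subalgebra ::
  "('k::real_normed_field \<Rightarrow> 'a::{real_normed_algebra, banach} \<Rightarrow> 'a) \<Rightarrow> 'a set \<Rightarrow> bool" where
  "closed_subalgebra scale S \<longleftrightarrow>
     module.subspace scale S \<and> closed S \<and> (\<forall>a\<in>S. \<forall>b\<in>S. a * b \<in> S)"

definition unital :: "'a::times set \<Rightarrow> bool" where
  "unital S \<longleftrightarrow> (\<exists>u\<in>S. \<forall>a\<in>S. u * a = a \<and> a * u = a)"

text \<open>
  In all that follows, \<open>S\<close> is a closed subalgebra of the ambient type, regarded as a Banach
  algebra in its own right (the whole algebra being \<open>UNIV\<close>). As \<open>S\<close> is closed,
  a subset of \<open>S\<close> is closed in \<open>S\<close> iff it is closed in the ambient type.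
\<close>

definition closed_ideal ::
  "('k::real_normed_field \<Rightarrow> 'a::{real_normed_algebra, banach} \<Rightarrow> 'a) \<Rightarrow> 'a set \<Rightarrow> 'a set \<Rightarrow> bool" where
  "closed_ideal scale S J \<longleftrightarrow>
     J \<subseteq> S \<and> module.subspace scale J \<and> closed J \<and>
     (\<forall>a\<in>S. \<forall>x\<in>J. a * x \<in> J \<and> x * a \<in> J)"

text \<open>
  Functionals on \<open>J\<close>, and maps defined on \<open>S\<close>, are represented by functions on the whole type
  that vanish outside their domain, so that equality of functions is equality on the domain.
\<close>

definition dual ::
  "('k::real_normed_field \<Rightarrow> 'a::{real_normed_algebra, banach} \<Rightarrow> 'a) \<Rightarrow> 'a set \<Rightarrow> ('a \<Rightarrow> 'k) set" where
  "dual scale J =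
     {\<xi>. (\<forall>x\<in>J. \<forall>y\<in>J. \<xi> (x + y) = \<xi> x + \<xi> y) \<and>
         (\<forall>c. \<forall>x\<in>J. \<xi> (scale c x) = c * \<xi> x) \<and>
         (\<exists>K. \<forall>x\<in>J. norm (\<xi> x) \<le> K * norm x) \<and>
         (\<forall>x. x \<notin> J \<longrightarrow> \<xi> x = 0)}"

definition dual_left :: "'a set \<Rightarrow> 'a::times \<Rightarrow> ('a \<Rightarrow> 'k::zero) \<Rightarrow> 'a \<Rightarrow> 'k" where
  "dual_left J a \<xi> = (\<lambda>x. if x \<in> J then \<xi> (x * a) else 0)"

definition dual_right :: "'a set \<Rightarrow> ('a \<Rightarrow> 'k) \<Rightarrow> 'a::times \<Rightarrow> 'a \<Rightarrow> 'k::zero" where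
  "dual_right J \<xi> a = (\<lambda>x. if x \<in> J then \<xi> (a * x) else 0)"

text \<open>
  The bound on \<open>D\<close> in the next definition is boundedness, i.e. continuity, of the linear map \<open>D\<close>
  from \<open>S\<close> to the dual of \<open>J\<close> with the dual norm.
\<close>

definition derivations ::
  "('k::real_normed_field \<Rightarrow> 'a::{real_normed_algebra, banach} \<Rightarrow> 'a) \<Rightarrow> 'a set \<Rightarrow> 'a set
     \<Rightarrow> ('a \<Rightarrow> 'a \<Rightarrow> 'k) set" where
  "derivations scale S J =
     {D. (\<forall>a\<in>S. D a \<in> dual scale J) \<and>
         (\<forall>a\<in>S. \<forall>b\<in>S. \<forall>x. D (a + b) x = D a x + D b x) \<and>
         (\<forall>c. \<forall>a\<in>S. \<forall>x. D (scale c a) x = c * D a x) \<and>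
         (\<exists>K. \<forall>a\<in>S. \<forall>x\<in>J. norm (D a x) \<le> K * norm a * norm x) \<and>
         (\<forall>a\<in>S. \<forall>b\<in>S. \<forall>x. D (a * b) x = dual_left J a (D b) x + dual_right J (D a) b x) \<and>
         (\<forall>a x. a \<notin> S \<longrightarrow> D a x = 0)}"

definition inner_derivations ::
  "('k::real_normed_field \<Rightarrow> 'a::{real_normed_algebra, banach} \<Rightarrow> 'a) \<Rightarrow> 'a set \<Rightarrow> 'a set
     \<Rightarrow> ('a \<Rightarrow> 'a \<Rightarrow> 'k) set" where
  "inner_derivations scale S J =
     {D. \<exists>\<xi>\<in>dual scale J.
           D = (\<lambda>a x. if a \<in> S then dual_left J a \<xi> x - dual_right J \<xi> a x else 0)}"

text \<open>
  First cohomology of \<open>S\<close> with coefficients in the dual of \<open>J\<close>, as a set of cosets; its zero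
  element is the coset \<open>inner_derivations scale S J\<close>.
\<close>

definition H1 ::
  "('k::real_normed_field \<Rightarrow> 'a::{real_normed_algebra, banach} \<Rightarrow> 'a) \<Rightarrow> 'a set \<Rightarrow> 'a set
     \<Rightarrow> ('a \<Rightarrow> 'a \<Rightarrow> 'k) set set" where
  "H1 scale S J =
     derivations scale S J //
       {(D, E). D \<in> derivations scale S J \<and> E \<in> derivations scale S J \<and>
                (\<lambda>a x. D a x - E a x) \<in> inner_derivations scale S J}"

definition ideally_amenable ::
  "('k::real_normed_field \<Rightarrow> 'a::{real_normed_algebra, banach} \<Rightarrow> 'a) \<Rightarrow> 'a set \<Rightarrow> bool" where
  "ideally_amenable scale S \<longleftrightarrow>
     (\<forall>J. closed_ideal scale S J \<longrightarrow> H1 scale S J = {inner_derivations scale S J})"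

end

theory Submission
  imports Defs
begin

text \<open>
  Everything rests on one observation: the identity \<open>u\<close> of \<open>B\<close> is a right unit of the whole
  algebra \<open>A\<close>. Write a given right unit of \<open>A\<close> as \<open>b + i\<close> with \<open>b \<in> B\<close> and \<open>i \<in> I\<close>. Since
  \<open>A I = 0\<close>, the component \<open>b\<close> is still a right unit, and then \<open>u = u b = b\<close>
  (\<open>identity_of_complement_is_right_unit\<close>).

  Consequently left multiplication by \<open>u\<close> is the projection of \<open>A = B \<oplus> I\<close> onto \<open>B\<close>: it fixes
  \<open>B\<close> and kills \<open>I\<close>. So this projection is visibly continuous, without the closed graph theorem,
  and it is multiplicative because \<open>(u a)(u c) = (u a u) c = u (a c)\<close>.

  For (i), \<open>J + I\<close> is the preimage of \<open>J\<close> under the projection, hence closed, and it is an ideal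
  because the projection is a homomorphism onto \<open>B\<close>.

  For (ii), a derivation \<open>D\<close> of \<open>B\<close> into the dual of \<open>J\<close> is inflated along the projection in both
  arguments to \<open>\<langle>D' a, x\<rangle> = \<langle>D (u a), u x\<rangle>\<close>, a derivation of \<open>A\<close> into the dual of \<open>J + I\<close>
  (\<open>inflated_derivation\<close>). If \<open>\<xi>\<close> implements \<open>D'\<close>, then the restriction of \<open>\<xi>\<close> to \<open>J\<close> implements
  \<open>D\<close>, because \<open>u\<close> acts as the identity on \<open>B\<close>.
\<close>

section \<open>Dual modules and inner derivations\<close>

context banach_algebra
begin

lemma closed_subalgebra_UNIV: "closed_subalgebra scale UNIV"
  by (simp add: closed_subalgebra_def)

lemma zero_in_dual: "(\<lambda>x. 0) \<in> dual scale J"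
  by (auto simp: dual_def intro: exI[of _ 0])

lemma dual_boundE:
  assumes "\<xi> \<in> dual scale J"
  obtains K where "K \<ge> 0" "\<And>x. x \<in> J \<Longrightarrow> norm (\<xi> x) \<le> K * norm x"
proof -
  obtain K where K: "\<And>x. x \<in> J \<Longrightarrow> norm (\<xi> x) \<le> K * norm x"
    using assms unfolding dual_def by blast
  have "norm (\<xi> x) \<le> \<bar>K\<bar> * norm x" if "x \<in> J" for x
    using K[OF that] mult_right_mono[OF abs_ge_self norm_ge_zero, of K x] by linarith
  then show ?thesis using that[of "\<bar>K\<bar>"] by simp
qed

lemma dual_diff:
  assumes "\<xi> \<in> dual scale J" "\<eta> \<in> dual scale J"
  shows "(\<lambda>x. \<xi> x - \<eta> x) \<in> dual scale J"
proof -
  obtain K where K: "\<And>x. x \<in> J \<Longrightarrow> norm (\<xi> x) \<le> K * norm x"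
    using dual_boundE[OF assms(1)] by blast
  obtain L where L: "\<And>x. x \<in> J \<Longrightarrow> norm (\<eta> x) \<le> L * norm x"
    using dual_boundE[OF assms(2)] by blast
  have "norm (\<xi> x - \<eta> x) \<le> (K + L) * norm x" if "x \<in> J" for x
    using norm_triangle_ineq4[of "\<xi> x" "\<eta> x"] K[OF that] L[OF that]
    by (simp add: distrib_right)
  then have "\<exists>M. \<forall>x\<in>J. norm (\<xi> x - \<eta> x) \<le> M * norm x" by blast
  then show ?thesis
    using assms by (simp add: dual_def right_diff_distrib)
qed

lemma dual_restrict:
  assumes "\<xi> \<in> dual scale M" "J \<subseteq> M" "subspace J"
  shows "(\<lambda>x. if x \<in> J then \<xi> x else 0) \<in> dual scale J"
proof -
  have "\<exists>K. \<forall>x\<in>J. norm (\<xi> x) \<le> K * norm x"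
    using assms(1,2) unfolding dual_def by blast
  then show ?thesis
    using assms by (simp add: dual_def subset_iff subspace_add subspace_scale)
qed

lemma dual_left_in_dual:
  assumes "\<xi> \<in> dual scale J" "subspace J" "\<And>x. x \<in> J \<Longrightarrow> x * a \<in> J"
  shows "dual_left J a \<xi> \<in> dual scale J"
proof -
  obtain K where "K \<ge> 0" and K: "\<And>x. x \<in> J \<Longrightarrow> norm (\<xi> x) \<le> K * norm x"
    using dual_boundE[OF assms(1)] by blast
  have "norm (\<xi> (x * a)) \<le> K * norm a * norm x" if "x \<in> J" for x
    using K[OF assms(3)[OF that]] mult_left_mono[OF norm_mult_ineq \<open>K \<ge> 0\<close>, of x a]
    by (simp add: mult_ac)
  then show ?thesis
    using assms
    by (auto simp: dual_def dual_left_def subspace_add subspace_scale distrib_right scale_mult_left)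
qed

lemma dual_right_in_dual:
  assumes "\<xi> \<in> dual scale J" "subspace J" "\<And>x. x \<in> J \<Longrightarrow> a * x \<in> J"
  shows "dual_right J \<xi> a \<in> dual scale J"
proof -
  obtain K where "K \<ge> 0" and K: "\<And>x. x \<in> J \<Longrightarrow> norm (\<xi> x) \<le> K * norm x"
    using dual_boundE[OF assms(1)] by blast
  have "norm (\<xi> (a * x)) \<le> K * norm a * norm x" if "x \<in> J" for x
    using K[OF assms(3)[OF that]] mult_left_mono[OF norm_mult_ineq \<open>K \<ge> 0\<close>, of a x]
    by (simp add: mult_ac)
  then show ?thesis
    using assms
    by (auto simp: dual_def dual_right_def subspace_add subspace_scale distrib_left scale_mult_right)
qed

lemma inner_derivations_subset_derivations:
  assumes "closed_subalgebra scale S" "closed_ideal scale S J"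
  shows "inner_derivations scale S J \<subseteq> derivations scale S J"
proof
  fix D assume "D \<in> inner_derivations scale S J"
  then obtain \<xi> where \<xi>: "\<xi> \<in> dual scale J"
    and D: "D = (\<lambda>a x. if a \<in> S then dual_left J a \<xi> x - dual_right J \<xi> a x else 0)"
    by (auto simp: inner_derivations_def)
  have S: "subspace S" "\<And>a b. a \<in> S \<Longrightarrow> b \<in> S \<Longrightarrow> a * b \<in> S"
    using assms(1) by (auto simp: closed_subalgebra_def)
  have J: "subspace J" "\<And>a x. a \<in> S \<Longrightarrow> x \<in> J \<Longrightarrow> a * x \<in> J"
    "\<And>a x. a \<in> S \<Longrightarrow> x \<in> J \<Longrightarrow> x * a \<in> J"
    using assms(2) by (auto simp: closed_ideal_def)
  have \<xi>_add: "\<xi> (x + y) = \<xi> x + \<xi> y" if "x \<in> J" "y \<in> J" for x y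
    using \<xi> that by (simp add: dual_def)
  have \<xi>_scale: "\<xi> (scale c x) = c * \<xi> x" if "x \<in> J" for c x
    using \<xi> that by (simp add: dual_def)
  obtain K where "K \<ge> 0" and K: "\<And>x. x \<in> J \<Longrightarrow> norm (\<xi> x) \<le> K * norm x"
    using dual_boundE[OF \<xi>] by blast
  have D_dual: "D a \<in> dual scale J" if "a \<in> S" for a
    using dual_diff[OF dual_left_in_dual[OF \<xi> J(1), of a] dual_right_in_dual[OF \<xi> J(1), of a]]
      J that by (simp add: D)
  have D_add: "D (a + b) x = D a x + D b x" if "a \<in> S" "b \<in> S" for a b x
    using that J subspace_add[OF S(1)]
    by (auto simp: D dual_left_def dual_right_def distrib_left distrib_right \<xi>_add)
  have D_scale: "D (scale c a) x = c * D a x" if "a \<in> S" for c a x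
    using that J subspace_scale[OF S(1)]
    by (auto simp: D dual_left_def dual_right_def scale_mult_left scale_mult_right \<xi>_scale
        right_diff_distrib)
  have D_bound: "norm (D a x) \<le> (K + K) * norm a * norm x" if "a \<in> S" "x \<in> J" for a x
  proof -
    have "norm (D a x) \<le> norm (\<xi> (x * a)) + norm (\<xi> (a * x))"
      using that by (simp add: D dual_left_def dual_right_def norm_triangle_ineq4)
    also have "\<dots> \<le> K * norm (x * a) + K * norm (a * x)"
      using K J that by (intro add_mono) auto
    also have "\<dots> \<le> K * (norm x * norm a) + K * (norm a * norm x)"
      using \<open>K \<ge> 0\<close> by (intro add_mono mult_left_mono norm_mult_ineq)
    finally show ?thesis by (simp add: algebra_simps)
  qed
  have D_mult: "D (a * b) x = dual_left J a (D b) x + dual_right J (D a) b x"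
    if "a \<in> S" "b \<in> S" for a b x
    using that J S by (auto simp: D dual_left_def dual_right_def mult.assoc)
  have D_off: "D a x = 0" if "a \<notin> S" for a x
    using that by (simp add: D)
  show "D \<in> derivations scale S J"
    unfolding derivations_def using D_dual D_add D_scale D_bound D_mult D_off by blast
qed

lemma zero_in_inner_derivations: "(\<lambda>a x. 0) \<in> inner_derivations scale S J"
  unfolding inner_derivations_def
  by (rule CollectI, rule bexI[OF _ zero_in_dual])
    (simp add: dual_left_def dual_right_def fun_eq_iff)

lemma inner_derivations_diff:
  assumes "D \<in> inner_derivations scale S J" "E \<in> inner_derivations scale S J"
  shows "(\<lambda>a x. D a x - E a x) \<in> inner_derivations scale S J"
proof -
  obtain \<xi> \<eta> where \<xi>: "\<xi> \<in> dual scale J" and \<eta>: "\<eta> \<in> dual scale J"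
    and D: "D = (\<lambda>a x. if a \<in> S then dual_left J a \<xi> x - dual_right J \<xi> a x else 0)"
    and E: "E = (\<lambda>a x. if a \<in> S then dual_left J a \<eta> x - dual_right J \<eta> a x else 0)"
    using assms by (auto simp: inner_derivations_def)
  show ?thesis
    unfolding inner_derivations_def
    by (rule CollectI, rule bexI[OF _ dual_diff[OF \<xi> \<eta>]])
      (auto simp: D E dual_left_def dual_right_def fun_eq_iff)
qed

text \<open>
  The quotient vanishes exactly when numerator and denominator agree; one inclusion always holds.
\<close>

lemma H1_trivial_iff:
  assumes "closed_subalgebra scale S" "closed_ideal scale S J"
  shows "H1 scale S J = {inner_derivations scale S J} \<longleftrightarrow>
         derivations scale S J \<subseteq> inner_derivations scale S J"
    (is "_ = {?N} \<longleftrightarrow> ?Z \<subseteq> _")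
proof -
  let ?R = "{(D, E). D \<in> ?Z \<and> E \<in> ?Z \<and> (\<lambda>a x. D a x - E a x) \<in> ?N}"
  have "?Z \<subseteq> ?N" if H: "H1 scale S J = {?N}"
  proof
    fix D assume D: "D \<in> ?Z"
    then have "?R `` {D} = ?N"
      using H quotientI[of D ?Z ?R] by (simp add: H1_def)
    moreover have "D \<in> ?R `` {D}"
      using D zero_in_inner_derivations by simp
    ultimately show "D \<in> ?N" by simp
  qed
  moreover have "H1 scale S J = {?N}" if "?Z \<subseteq> ?N"
  proof -
    have eq: "?Z = ?N"
      using that inner_derivations_subset_derivations[OF assms] by blast
    have "?R `` {D} = ?N" if "D \<in> ?N" for D
      using that inner_derivations_diff by (auto simp: eq)
    then show ?thesis
      using zero_in_inner_derivations[of S J] by (auto simp: H1_def quotient_def eq)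
  qed
  ultimately show ?thesis by blast
qed

end

section \<open>Splitting off an ideal of right annihilators\<close>

text \<open>
  The ideal component of a right unit contributes nothing to right multiplication, so the component
  in \<open>B\<close> is a right unit by itself; a left unit and a right unit of \<open>B\<close> coincide.
\<close>

lemma identity_of_complement_is_right_unit:
  fixes u e :: "'a::ring"
  assumes "\<And>a. a * e = a" and "direct_sum UNIV B I"
    and "\<And>a x. x \<in> I \<Longrightarrow> a * x = 0"
    and "\<And>b. b \<in> B \<Longrightarrow> u * b = b"
  shows "a * u = a"
proof -
  obtain b i where bi: "b \<in> B" "i \<in> I" "e = b + i"
    using assms(2) by (metis UNIV_I direct_sum_def set_plus_elim)
  have b_right: "c * b = c" for c
    using assms(1)[of c] assms(3)[OF bi(2), of c] by (simp add: bi(3) distrib_left)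
  have "u = b"
    using b_right[of u] assms(4)[OF bi(1)] by simp
  then show ?thesis by (simp add: b_right)
qed

text \<open>
  The situation of the theorem, with the identity \<open>u\<close> of \<open>B\<close> already known to be a right unit of
  the whole algebra.
\<close>

locale right_annihilator_splitting = banach_algebra scale
  for scale :: "'k::real_normed_field \<Rightarrow> 'a::{real_normed_algebra, banach} \<Rightarrow> 'a" +
  fixes B I :: "'a set" and u :: 'a
  assumes splitting: "direct_sum UNIV B I"
    and subalgebra: "closed_subalgebra scale B"
    and ideal: "closed_ideal scale UNIV I"
    and annihilates: "x \<in> I \<Longrightarrow> a * x = 0"
    and u_left: "b \<in> B \<Longrightarrow> u * b = b"
    and u_right: "a * u = a"
begin

lemma splitE:
  obtains b i where "b \<in> B" "i \<in> I" "a = b + i"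
  using splitting by (metis UNIV_I direct_sum_def set_plus_elim)

lemma projection_in: "u * a \<in> B"
  by (rule splitE[of a]) (simp add: distrib_left annihilates u_left)

lemma remainder_in: "a - u * a \<in> I"
  by (rule splitE[of a]) (simp add: distrib_left annihilates u_left)

lemma projection_mult: "u * (a * c) = (u * a) * (u * c)"
  by (metis mult.assoc u_right)

lemma mem_sum_iff:
  assumes "J \<subseteq> B"
  shows "x \<in> J + I \<longleftrightarrow> u * x \<in> J"
proof
  assume "x \<in> J + I"
  then obtain j i where "j \<in> J" "i \<in> I" "x = j + i" by (rule set_plus_elim)
  then show "u * x \<in> J"
    using assms by (simp add: distrib_left annihilates u_left subset_iff)
next
  assume "u * x \<in> J"
  then show "x \<in> J + I"
    using set_plus_intro[OF _ remainder_in[of x], of "u * x" J] by simp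
qed

lemma ideal_sum:
  assumes "closed_ideal scale B J"
  shows "closed_ideal scale UNIV (J + I)"
proof -
  have J: "J \<subseteq> B" "subspace J" "closed J" "\<And>b x. b \<in> B \<Longrightarrow> x \<in> J \<Longrightarrow> b * x \<in> J"
    "\<And>b x. b \<in> B \<Longrightarrow> x \<in> J \<Longrightarrow> x * b \<in> J"
    using assms by (auto simp: closed_ideal_def)
  have "closed ((\<lambda>x. u * x) -` J)"
    by (intro closed_vimage J(3) continuous_intros)
  moreover have "J + I = (\<lambda>x. u * x) -` J"
    using mem_sum_iff[OF J(1)] by auto
  ultimately have "closed (J + I)" by simp
  moreover have "subspace (J + I)"
    using subspace_0[OF J(2)] subspace_add[OF J(2)] subspace_scale[OF J(2)]
    by (auto simp: subspace_def mem_sum_iff[OF J(1)] distrib_left scale_mult_right)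
  ultimately show ?thesis
    using J(4,5) projection_in
    by (auto simp: closed_ideal_def mem_sum_iff[OF J(1)] projection_mult)
qed

lemma direct_sum_ideal:
  assumes "closed_ideal scale B J"
  shows "direct_sum (J + I) J I"
proof -
  have "0 \<in> J" "0 \<in> I" "J \<subseteq> B" "B \<inter> I = {0}"
    using assms ideal splitting
    by (auto simp: closed_ideal_def direct_sum_def subspace_0)
  then show ?thesis by (auto simp: direct_sum_def)
qed

text \<open>
  Pulling back along the homomorphism \<open>a \<mapsto> u a\<close> preserves the derivation identity; since it maps
  \<open>J + I\<close> into \<open>J\<close> and its complement into the complement of \<open>J\<close>, the pulled back functionals
  vanish where they should.
\<close>

lemma inflated_derivation:
  assumes J: "closed_ideal scale B J" and D: "D \<in> derivations scale B J"
  shows "(\<lambda>a x. D (u * a) (u * x)) \<in> derivations scale UNIV (J + I)"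
proof -
  have "J \<subseteq> B" using J by (simp add: closed_ideal_def)
  note mem = mem_sum_iff[OF \<open>J \<subseteq> B\<close>]
  have "\<exists>K. \<forall>b\<in>B. \<forall>x\<in>J. norm (D b x) \<le> K * norm b * norm x"
    using D by (simp add: derivations_def)
  then obtain K where K: "\<And>b x. b \<in> B \<Longrightarrow> x \<in> J \<Longrightarrow> norm (D b x) \<le> K * norm b * norm x"
    by blast
  define L where "L = \<bar>K\<bar> * norm u * norm u"
  have bound: "norm (D (u * a) (u * x)) \<le> L * norm a * norm x" if "x \<in> J + I" for a x
  proof -
    have "norm (D (u * a) (u * x)) \<le> K * norm (u * a) * norm (u * x)"
      using K projection_in that by (simp add: mem)
    also have "\<dots> \<le> \<bar>K\<bar> * (norm u * norm a) * (norm u * norm x)"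
      by (intro mult_mono norm_mult_ineq) auto
    finally show ?thesis by (simp add: L_def mult_ac)
  qed
  have functional: "(\<lambda>x. D (u * a) (u * x)) \<in> dual scale (J + I)" for a
  proof -
    have "D (u * a) \<in> dual scale J"
      using D projection_in by (simp add: derivations_def)
    moreover have "\<exists>M. \<forall>x\<in>J + I. norm (D (u * a) (u * x)) \<le> M * norm x"
      using bound by blast
    ultimately show ?thesis
      by (simp add: dual_def mem distrib_left scale_mult_right)
  qed
  have product: "D (u * (a * c)) (u * x) =
      dual_left (J + I) a (\<lambda>x. D (u * c) (u * x)) x +
      dual_right (J + I) (\<lambda>x. D (u * a) (u * x)) c x" for a c x
  proof -
    have "D (u * (a * c)) (u * x) =
        dual_left J (u * a) (D (u * c)) (u * x) + dual_right J (D (u * a)) (u * c) (u * x)"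
      using D projection_in by (simp add: derivations_def projection_mult)
    then show ?thesis
      by (simp add: dual_left_def dual_right_def mem projection_mult)
  qed
  have "\<exists>M. \<forall>a. \<forall>x\<in>J + I. norm (D (u * a) (u * x)) \<le> M * norm a * norm x"
    using bound by blast
  then show ?thesis
    using D projection_in functional product
    by (simp add: derivations_def distrib_left scale_mult_right)
qed

lemma inner_if_inflated_inner:
  assumes J: "closed_ideal scale B J" and D: "D \<in> derivations scale B J"
    and inner: "(\<lambda>a x. D (u * a) (u * x)) \<in> inner_derivations scale UNIV (J + I)"
  shows "D \<in> inner_derivations scale B J"
proof -
  have JB: "J \<subseteq> B" "subspace J" "\<And>b x. b \<in> B \<Longrightarrow> x \<in> J \<Longrightarrow> b * x \<in> J"
    "\<And>b x. b \<in> B \<Longrightarrow> x \<in> J \<Longrightarrow> x * b \<in> J"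
    using J by (auto simp: closed_ideal_def)
  have sub: "J \<subseteq> J + I"
    using JB(1) by (auto simp: mem_sum_iff u_left subset_iff)
  obtain \<xi> where \<xi>: "\<xi> \<in> dual scale (J + I)"
    and eq: "\<And>a x. D (u * a) (u * x) = dual_left (J + I) a \<xi> x - dual_right (J + I) \<xi> a x"
    using inner by (auto simp: inner_derivations_def fun_eq_iff)
  define \<eta> where "\<eta> = (\<lambda>x. if x \<in> J then \<xi> x else 0)"
  have "D a x = (if a \<in> B then dual_left J a \<eta> x - dual_right J \<eta> a x else 0)" for a x
  proof (cases "a \<in> B \<and> x \<in> J")
    case True
    then have "D a x = D (u * a) (u * x)"
      using JB(1) by (simp add: u_left subset_iff)
    also have "\<dots> = \<xi> (x * a) - \<xi> (a * x)"
      using True sub by (auto simp: eq dual_left_def dual_right_def)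
    finally show ?thesis
      using True JB by (simp add: dual_left_def dual_right_def \<eta>_def)
  next
    case False
    then show ?thesis
      using D by (auto simp: derivations_def dual_def dual_left_def dual_right_def)
  qed
  then have "D = (\<lambda>a x. if a \<in> B then dual_left J a \<eta> x - dual_right J \<eta> a x else 0)"
    by (simp add: fun_eq_iff)
  moreover have "\<eta> \<in> dual scale J"
    unfolding \<eta>_def by (rule dual_restrict[OF \<xi> sub JB(2)])
  ultimately show ?thesis
    unfolding inner_derivations_def by blast
qed

lemma ideally_amenable_complement:
  assumes "ideally_amenable scale UNIV"
  shows "ideally_amenable scale B"
  unfolding ideally_amenable_def
proof (intro allI impI)
  fix J assume J: "closed_ideal scale B J"
  have "derivations scale UNIV (J + I) \<subseteq> inner_derivations scale UNIV (J + I)"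
    using assms ideal_sum[OF J] H1_trivial_iff[OF closed_subalgebra_UNIV ideal_sum[OF J]]
    by (simp add: ideally_amenable_def)
  then have "derivations scale B J \<subseteq> inner_derivations scale B J"
    using inflated_derivation[OF J] inner_if_inflated_inner[OF J] by blast
  then show "H1 scale B J = {inner_derivations scale B J}"
    by (simp add: H1_trivial_iff[OF subalgebra J])
qed

end

theorem lemma3p1:
  fixes scale :: "'k::real_normed_field \<Rightarrow> 'a::{real_normed_algebra, banach} \<Rightarrow> 'a"
    and B I :: "'a set"
  assumes "banach_algebra scale"
    and "\<exists>e::'a. \<forall>a. a * e = a"
    and "direct_sum UNIV B I"
    and "closed_subalgebra scale B" and "unital B"
    and "closed_ideal scale UNIV I"
    and "\<forall>a. \<forall>x\<in>I. a * x = 0"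
  shows "(\<forall>J. closed_ideal scale B J \<longrightarrow>
            direct_sum (J + I) J I \<and> closed_ideal scale UNIV (J + I)) \<and>
         (ideally_amenable scale UNIV \<longrightarrow> ideally_amenable scale B)"
proof -
  obtain e :: 'a where e: "\<And>a. a * e = a"
    using assms(2) by blast
  obtain u where u: "u \<in> B" "\<And>b. b \<in> B \<Longrightarrow> u * b = b"
    using assms(5) by (auto simp: unital_def)
  have "a * u = a" for a
    using identity_of_complement_is_right_unit[OF e assms(3) _ u(2)] assms(7) by blast
  then interpret right_annihilator_splitting scale B I u
    using assms u
    by (auto simp: right_annihilator_splitting_def right_annihilator_splitting_axioms_def)
  show ?thesis
    using ideal_sum direct_sum_ideal ideally_amenable_complement by blast
qed

end
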